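(* Let $X,Y$ be nonempty sets, let $c\colon X\times Y\to\mathbb{R}\cup\{+\infty\}$ be a cost with nonempty domain $D$, and let $G$ be a nonempty subset of $D$ that is $c$-path bounded. Suppose that there is a nonempty finite subset $A$ of $G$ such that for every $(x,y)\in G$ there exist a point $(x_s,y_s)\in A$ and a path in $G$ from $(x_s,y_s)$ to $(x,y)$. Then the function $$f\colon G\to[-\infty,+\infty],\qquad f(x,y)=-\sup_{(x_s,y_s)\in A}F_G\big((x_s,y_s),(x,y)\big)$$ is a $c$-antiderivative of $G$ (in particular, it is real-valued).
   Context: $D:=\{(x,y)\in X\times Y: c(x,y)<+\infty\}$. Convention: $r-(+\infty)=-\infty$ for $r\in\mathbb{R}$. Path: for a nonempty $G\subseteq D$ and $(x_s,y_s),(x_e,y_e)\in G$, a path in $G$ from $(x_s,y_s)$ to $(x_e,y_e)$ is a finite sequence $((x_k,y_k))_{k=1}^{N+1}$ in $G$ ($N\ge 1$) with $(x_1,y_1)=(x_s,y_s)$, $(x_{N+1},y_{N+1})=(x_e,y_e)$ and $c(x_{k+1},y_k)<+\infty$ for every $k\in\{1,\dots,N\}$. Maximal inner variation: $F_G\big((x_s,y_s),(x_e,y_e)\big):=\sup\sum_{k=1}^N\big(c(x_k,y_k)-c(x_{k+1},y_k)\big)\in[-\infty,+\infty]$, the supremum being over all paths in $G$ from $(x_s,y_s)$ to $(x_e,y_e)$, with $\sup\varnothing=-\infty$. $G$ is $c$-path bounded if $F_G\big((x_s,y_s),(x_e,y_e)\big)<+\infty$ for all $(x_s,y_s),(x_e,y_e)\in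 G$. $c$-antiderivative: a function $f\colon G\to\mathbb{R}$ is a $c$-antiderivative of $G$ if $c(x,y)-c(u,y)\le f(x,y)-f(u,v)$ for all $(x,y),(u,v)\in G$. *)

theory Defs
  imports Complex_Main "HOL-Library.Extended_Real"
begin

(* A cost X x Y -> R \<union> {+\<infinity>} is a function into ereal that avoids -\<infinity> on X \<times> Y;
   its values outside X \<times> Y are never used. *)

definition cost_domain :: "'x set \<Rightarrow> 'y set \<Rightarrow> ('x \<times> 'y \<Rightarrow> ereal) \<Rightarrow> ('x \<times> 'y) set" where
  "cost_domain X Y c = {p \<in> X \<times> Y. c p < \<infinity>}"

(* The sequence is p 1, ..., p (N + 1); the values of p at other indices are irrelevant. *)

definition is_path :: "('x \<times> 'y \<Rightarrow> ereal) \<Rightarrow> ('x \<times> 'y) set \<Rightarrow> 'x \<times> 'y \<Rightarrow> 'x \<times> 'y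
    \<Rightarrow> nat \<Rightarrow> (nat \<Rightarrow> 'x \<times> 'y) \<Rightarrow> bool" where
  "is_path c G s e N p \<longleftrightarrow>
     N \<ge> 1 \<and> (\<forall>k\<in>{1..N+1}. p k \<in> G) \<and> p 1 = s \<and> p (N+1) = e \<and>
     (\<forall>k\<in>{1..N}. c (fst (p (k+1)), snd (p k)) < \<infinity>)"

(* For G inside the cost domain, every summand along a path is finite, so the sums are
   unaffected by the convention \<infinity> - \<infinity> = \<infinity> on ereal. The supremum of the
   empty set is -\<infinity>. *)

definition max_inner_variation :: "('x \<times> 'y \<Rightarrow> ereal) \<Rightarrow> ('x \<times> 'y) set
    \<Rightarrow> 'x \<times> 'y \<Rightarrow> 'x \<times> 'y \<Rightarrow> ereal" where
  "max_inner_variation c G s e =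
     Sup {(\<Sum>k=1..N. c (p k) - c (fst (p (k+1)), snd (p k))) | N p. is_path c G s e N p}"

definition c_path_bounded :: "('x \<times> 'y \<Rightarrow> ereal) \<Rightarrow> ('x \<times> 'y) set \<Rightarrow> bool" where
  "c_path_bounded c G \<longleftrightarrow> (\<forall>s\<in>G. \<forall>e\<in>G. max_inner_variation c G s e < \<infinity>)"

(* The left-hand side is -\<infinity> when c (u, y) = \<infinity>, since c (x, y) is finite on G. *)

definition c_antiderivative :: "('x \<times> 'y \<Rightarrow> ereal) \<Rightarrow> ('x \<times> 'y) set
    \<Rightarrow> ('x \<times> 'y \<Rightarrow> real) \<Rightarrow> bool" where
  "c_antiderivative c G f \<longleftrightarrow>
     (\<forall>(x, y)\<in>G. \<forall>(u, v)\<in>G. c (x, y) - c (u, y) \<le> ereal (f (x, y) - f (u, v)))"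

end

theory Submission
  imports Defs
begin

text \<open>
  Write \<open>S q\<close> for the supremum of \<open>F\<^sub>G(s, q)\<close> over \<open>s \<in> A\<close>, so that \<open>f = -S\<close>. The idea is
  dynamic programming: \<open>S q\<close> is the best variation collected on the way from \<open>A\<close> to \<open>q\<close>, and a
  path that ends at \<open>q = (x, y)\<close> can be prolonged by one step to any \<open>r = (u, v)\<close> in \<open>G\<close> with
  \<open>c(u, y) < \<infinity>\<close>, which collects \<open>c(x, y) - c(u, y)\<close> more. Hence
  \<open>S q + (c(x, y) - c(u, y)) \<le> S r\<close> (lemma \<open>max_inner_variation_step\<close>, for each starting
  point separately), and once \<open>S\<close> is real-valued this is exactly the
  antiderivative inequality for \<open>-S\<close>. If \<open>c(u, y) = \<infinity>\<close>, the inequality is trivial.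

  That \<open>S\<close> is real-valued uses both properties of \<open>A\<close>. It is finite, so \<open>S q\<close> is a maximum of
  finitely many values, each below \<open>\<infinity>\<close> by path boundedness; it reaches every \<open>q \<in> G\<close> by a
  path, and the variation along a path is a real number (lemma \<open>inner_variation_real\<close>), so
  \<open>S q > -\<infinity>\<close>.
\<close>

lemma path_extend:
  assumes path: "is_path c G s q N p" and "r \<in> G" and "c (fst r, snd q) < \<infinity>"
  shows "is_path c G s r (N + 1) (p(N + 2 := r))"
  using assms unfolding is_path_def
  by (auto simp: le_Suc_eq)

lemma inner_variation_extend:
  assumes "is_path c G s q N p"
  shows "(\<Sum>k=1..N+1. c ((p(N + 2 := r)) k)
            - c (fst ((p(N + 2 := r)) (k + 1)), snd ((p(N + 2 := r)) k)))
       = (\<Sum>k=1..N. c (p k) - c (fst (p (k + 1)), snd (p k))) + (c q - c (fst r, snd q))"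
proof -
  have "p (Suc N) = q" using assms by (simp add: is_path_def)
  moreover have "(\<Sum>k=1..N. c ((p(N + 2 := r)) k)
            - c (fst ((p(N + 2 := r)) (k + 1)), snd ((p(N + 2 := r)) k)))
       = (\<Sum>k=1..N. c (p k) - c (fst (p (k + 1)), snd (p k)))"
    by (rule sum.cong) auto
  ultimately show ?thesis by simp
qed

lemma inner_variation_le_max:
  assumes "is_path c G s e N p"
  shows "(\<Sum>k=1..N. c (p k) - c (fst (p (k + 1)), snd (p k))) \<le> max_inner_variation c G s e"
  unfolding max_inner_variation_def by (rule Sup_upper) (use assms in blast)

text \<open>
  Finiteness of the increment is what allows it to be moved through the supremum over paths, by
  writing the claim as \<open>F\<^sub>G(s, q) \<le> F\<^sub>G(s, r) - d\<close>.
\<close>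

lemma max_inner_variation_step:
  assumes "r \<in> G" and "c (fst r, snd q) < \<infinity>"
    and d: "c q - c (fst r, snd q) = ereal d"
  shows "max_inner_variation c G s q + ereal d \<le> max_inner_variation c G s r"
proof -
  have "max_inner_variation c G s q \<le> max_inner_variation c G s r - ereal d"
    unfolding max_inner_variation_def[of c G s q]
  proof (rule Sup_least, safe)
    fix N p assume p: "is_path c G s q N p"
    from inner_variation_le_max[OF path_extend[OF p assms(1,2)]]
    show "(\<Sum>k=1..N. c (p k) - c (fst (p (k + 1)), snd (p k)))
        \<le> max_inner_variation c G s r - ereal d"
      unfolding inner_variation_extend[OF p] d by (simp add: ereal_le_minus)
  qed
  then show ?thesis by (simp add: ereal_le_minus)
qed

text \<open>
  The reason why a reachable point has a maximal inner variation above \<open>-\<infinity>\<close>: in each summand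
  the first cost is below \<open>\<infinity>\<close> because \<open>G\<close> lies in the cost domain, the second by the
  definition of a path, and neither is \<open>-\<infinity>\<close>.
\<close>

lemma inner_variation_real:
  assumes path: "is_path c G s e N p" and G: "G \<subseteq> cost_domain X Y c"
    and c: "\<And>x y. x \<in> X \<Longrightarrow> y \<in> Y \<Longrightarrow> c (x, y) \<noteq> -\<infinity>"
  shows "\<bar>\<Sum>k=1..N. c (p k) - c (fst (p (k + 1)), snd (p k))\<bar> \<noteq> \<infinity>"
proof -
  have "\<bar>c (p k) - c (fst (p (k + 1)), snd (p k))\<bar> \<noteq> \<infinity>" if k: "k \<in> {1..N}" for k
  proof -
    have "k \<in> {1..N+1}" "k + 1 \<in> {1..N+1}" using k by auto
    then have "p k \<in> cost_domain X Y c" "p (k + 1) \<in> cost_domain X Y c"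
      using path G unfolding is_path_def by blast+
    then have "c (p k) < \<infinity>" "c (p k) \<noteq> -\<infinity>" "c (fst (p (k + 1)), snd (p k)) \<noteq> -\<infinity>"
      using c by (auto simp: cost_domain_def mem_Times_iff) (metis prod.collapse)
    moreover have "c (fst (p (k + 1)), snd (p k)) < \<infinity>"
      using path k unfolding is_path_def by blast
    ultimately show ?thesis
      by (cases "c (p k)"; cases "c (fst (p (k + 1)), snd (p k))") auto
  qed
  then show ?thesis by (simp add: sum_Inf)
qed

theorem theorem3p4:
  fixes X :: "'x set" and Y :: "'y set"
    and c :: "'x \<times> 'y \<Rightarrow> ereal"
    and G A :: "('x \<times> 'y) set"
    and f :: "'x \<times> 'y \<Rightarrow> ereal"
  assumes "X \<noteq> {}" and "Y \<noteq> {}"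
    and "\<And>x y. x \<in> X \<Longrightarrow> y \<in> Y \<Longrightarrow> c (x, y) \<noteq> -\<infinity>"
    and "cost_domain X Y c \<noteq> {}"
    and "G \<noteq> {}" and "G \<subseteq> cost_domain X Y c"
    and "c_path_bounded c G"
    and "A \<noteq> {}" and "finite A" and "A \<subseteq> G"
    and "\<And>q. q \<in> G \<Longrightarrow> \<exists>s\<in>A. \<exists>N p. is_path c G s q N p"
    and "\<And>q. q \<in> G \<Longrightarrow> f q = - (SUP s\<in>A. max_inner_variation c G s q)"
  shows "(\<forall>q\<in>G. \<bar>f q\<bar> \<noteq> \<infinity>) \<and> c_antiderivative c G (\<lambda>q. real_of_ereal (f q))"
proof -
  define S where "S q = (SUP s\<in>A. max_inner_variation c G s q)" for q
  have S_real: "\<bar>S q\<bar> \<noteq> \<infinity>" if q: "q \<in> G" for q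
  proof -
    have "S q \<in> (\<lambda>s. max_inner_variation c G s q) ` A"
      unfolding S_def using assms(8,9) by (simp add: finite_Sup_in sup_max max_def)
    then obtain t where "t \<in> A" "S q = max_inner_variation c G t q" by blast
    then have upper: "S q < \<infinity>"
      using assms(7,10) q unfolding c_path_bounded_def by (metis subsetD)
    obtain s N p where s: "s \<in> A" and p: "is_path c G s q N p"
      using assms(11)[OF q] by blast
    define v where "v = (\<Sum>k=1..N. c (p k) - c (fst (p (k + 1)), snd (p k)))"
    have "v \<le> max_inner_variation c G s q" unfolding v_def by (rule inner_variation_le_max[OF p])
    also have "\<dots> \<le> S q" unfolding S_def using s by (rule SUP_upper)
    finally have "v \<le> S q" .
    moreover have "\<bar>v\<bar> \<noteq> \<infinity>"
      unfolding v_def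
      by (rule inner_variation_real[OF p assms(6)]) (rule assms(3))
    ultimately show ?thesis
      using upper by (cases v; cases "S q") simp_all
  qed
  have f_real: "\<bar>f q\<bar> \<noteq> \<infinity>" and f_S: "real_of_ereal (f q) = - real_of_ereal (S q)"
    if "q \<in> G" for q
    using S_real[OF that] assms(12)[OF that] unfolding S_def by simp_all
  have "c (x, y) - c (u, y) \<le> ereal (real_of_ereal (f (x, y)) - real_of_ereal (f (u, v)))"
    if q: "(x, y) \<in> G" and r: "(u, v) \<in> G" for x y u v
  proof -
    have "x \<in> X" "y \<in> Y" "u \<in> X" and fin: "c (x, y) < \<infinity>"
      using q r assms(6) by (auto simp: cost_domain_def)
    then have "c (x, y) \<noteq> -\<infinity>" "c (u, y) \<noteq> -\<infinity>" using assms(3) by auto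
    with fin obtain a where a: "c (x, y) = ereal a" by (cases "c (x, y)") auto
    show ?thesis
    proof (cases "c (u, y) = \<infinity>")
      case True
      then show ?thesis using a by simp
    next
      case False
      then obtain b where b: "c (u, y) = ereal b"
        using \<open>c (u, y) \<noteq> -\<infinity>\<close> by (cases "c (u, y)") auto
      have "max_inner_variation c G s (x, y) + ereal (a - b) \<le> S (u, v)" if "s \<in> A" for s
        using max_inner_variation_step[OF r, of c "(x, y)" "a - b" s] a b
          SUP_upper[OF that, of "\<lambda>s. max_inner_variation c G s (u, v)"]
        unfolding S_def by (auto intro: order_trans)
      then have "S (x, y) \<le> S (u, v) - ereal (a - b)"
        unfolding S_def[of "(x, y)"] by (intro SUP_least) (simp add: ereal_le_minus)
      then show ?thesis
        using S_real[OF q] S_real[OF r]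
        by (cases "S (x, y)"; cases "S (u, v)") (simp_all add: a b f_S[OF q] f_S[OF r])
    qed
  qed
  then show ?thesis
    using f_real unfolding c_antiderivative_def case_prod_unfold by (metis prod.collapse)
qed

end
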